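(* Let $g\in\mathbb{R}^n\setminus\{0\}$, let $H$ be a real symmetric $n\times n$ matrix, and let $\rho:\mathbb{R}\to[0,\infty]$ be a proper closed convex function with $\rho(0)=0$. Suppose that: (1) $\rho$ is nondecreasing, $\rho(t)=0$ for all $t\le 0$, and there exists $t_0>0$ with $\rho(t_0)<\infty$; (2) $\lim_{t\to\infty}\rho(t)/t=\infty$. Let $v_{\rho r}:=\inf_{x\in\mathbb{R}^n}\ 2g^Tx+x^THx+\rho(\|x\|^2)$, and consider the concave maximization problem (the RW-dual) $$v_{{\rm RW}d}:=\sup_{t\in\mathbb{R}}\ \widehat k(t)-t,\qquad \widehat k(t):=\inf_{\gamma\ge 0}\left\{\rho(\gamma-1)+\gamma\,\lambda_{\min}\left(\begin{bmatrix}t&g^T\\ g&H\end{bmatrix}\right)\right\}.$$ Then $v_{{\rm RW}d}=v_{\rho r}$, and the supremum defining $v_{{\rm RW}d}$ is attained (a solution of the RW-dual exists).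
   Context: $\|\cdot\|$ is the Euclidean norm and $\lambda_{\min}(A)$ is the smallest eigenvalue of a real symmetric matrix $A$. *)

theory Defs
  imports "HOL-Analysis.Analysis"
begin

text \<open>Convex analysis for extended-real-valued functions on the line. As usual, such a
  function is called convex (closed) when its epigraph, a subset of the plane, is convex (closed).
  The library's \<open>epigraph\<close> only covers real-valued functions.\<close>

definition ereal_epigraph :: "(real \<Rightarrow> ereal) \<Rightarrow> (real \<times> real) set" where
  "ereal_epigraph f = {(t, r). f t \<le> ereal r}"

definition proper_fun :: "(real \<Rightarrow> ereal) \<Rightarrow> bool" where
  "proper_fun f \<longleftrightarrow> (\<exists>t. f t < \<infinity>) \<and> (\<forall>t. f t > -\<infinity>)"

definition closed_fun :: "(real \<Rightarrow> ereal) \<Rightarrow> bool" where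
  "closed_fun f \<longleftrightarrow> closed (ereal_epigraph f)"

definition convex_fun :: "(real \<Rightarrow> ereal) \<Rightarrow> bool" where
  "convex_fun f \<longleftrightarrow> convex (ereal_epigraph f)"

definition is_eigenvalue :: "real ^ 'm ^ 'm \<Rightarrow> real \<Rightarrow> bool" where
  "is_eigenvalue A l \<longleftrightarrow> (\<exists>v. v \<noteq> 0 \<and> A *v v = l *\<^sub>R v)"

text \<open>Only meaningful for symmetric matrices, where the least eigenvalue exists.\<close>

definition lambda_min :: "real ^ 'm ^ 'm \<Rightarrow> real" where
  "lambda_min A = (LEAST l. is_eigenvalue A l)"

text \<open>The matrix with first row \<open>(t, g\<^sup>T)\<close> and second block row \<open>(g, H)\<close>, of size \<open>n + 1\<close>: the extra
  index is \<open>None\<close>, and the original indices \<open>i\<close> become \<open>Some i\<close>.\<close>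

definition bordered :: "real \<Rightarrow> real ^ 'n \<Rightarrow> real ^ 'n ^ 'n \<Rightarrow> real ^ ('n option) ^ ('n option)" where
  "bordered t g H = (\<chi> i j. case i of
       None \<Rightarrow> (case j of None \<Rightarrow> t | Some j' \<Rightarrow> g $ j')
     | Some i' \<Rightarrow> (case j of None \<Rightarrow> g $ i' | Some j' \<Rightarrow> H $ i' $ j'))"

definition v_rho_r :: "(real \<Rightarrow> ereal) \<Rightarrow> real ^ 'n \<Rightarrow> real ^ 'n ^ 'n \<Rightarrow> ereal" where
  "v_rho_r \<rho> g H =
     (INF x. ereal (2 * (g \<bullet> x) + x \<bullet> (H *v x)) + \<rho> ((norm x)\<^sup>2))"

definition k_hat :: "(real \<Rightarrow> ereal) \<Rightarrow> real ^ 'n \<Rightarrow> real ^ 'n ^ 'n \<Rightarrow> real \<Rightarrow> ereal" where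
  "k_hat \<rho> g H t =
     (INF \<gamma> \<in> {0..}. \<rho> (\<gamma> - 1) + ereal (\<gamma> * lambda_min (bordered t g H)))"

definition v_RWd :: "(real \<Rightarrow> ereal) \<Rightarrow> real ^ 'n \<Rightarrow> real ^ 'n ^ 'n \<Rightarrow> ereal" where
  "v_RWd \<rho> g H = (SUP t. k_hat \<rho> g H t - ereal t)"

end

theory Submission
  imports Defs
begin

text \<open>
  Weak duality is the Rayleigh bound for the bordered matrix at the vector \<open>(1, x)\<close>.
  For strong duality, write \<open>Q x = 2 g\<^sup>T x + x\<^sup>T H x\<close>. The image of \<open>x \<mapsto> (\<parallel>x\<parallel>\<^sup>2, Q x)\<close>, thickened
  upwards, is convex: a convex combination of two points can be pushed along an eigenvector of the
  least eigenvalue of \<open>H\<close> until its squared norm is the average one, without spoiling the bound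
  on \<open>Q\<close>. Superlinear growth of \<open>\<rho>\<close> gives a primal minimizer \<open>x\<close>, and separating this convex set
  from the points \<open>(s, b)\<close> with \<open>\<rho> s + b\<close> below the optimal value gives a slope \<open>c\<close> which is a
  subgradient of \<open>\<rho>\<close> at \<open>\<parallel>x\<parallel>\<^sup>2\<close> and for which \<open>x\<close> minimizes \<open>Q + c \<parallel>\<cdot>\<parallel>\<^sup>2\<close>. Then \<open>H + c I\<close> is positive
  semidefinite with \<open>(H + c I) x = - g\<close>, and for \<open>t = - c - g\<^sup>T x\<close> the bordered matrix has least
  eigenvalue \<open>- c\<close> with eigenvector \<open>(1, x)\<close>, which makes \<open>t\<close> optimal for the dual.
\<close>

section \<open>Quadratic forms of symmetric matrices and their minimizers\<close>

lemma symmetric_matrix_inner: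
  fixes A :: "real ^ 'm ^ 'm"
  assumes "transpose A = A"
  shows "x \<bullet> (A *v y) = y \<bullet> (A *v x)"
  by (metis assms dot_lmul_matrix inner_commute transpose_matrix_vector)

lemma linear_coeff_zero_if_quadratic_nonneg:
  fixes a b :: real
  assumes "\<And>e. 0 \<le> 2 * e * a + e\<^sup>2 * b"
  shows "a = 0"
proof (rule ccontr)
  assume "a \<noteq> 0"
  define d where "d = \<bar>b\<bar> + 1"
  have d: "d > 0" "b < d" by (auto simp: d_def)
  \<comment> \<open>A step against the sign of \<open>a\<close>, short enough (since
    \<open>d > b\<close>) for the linear term to outweigh the quadratic one.\<close>
  have "0 \<le> 2 * (- a / d) * a + (- a / d)\<^sup>2 * b" by (rule assms)
  also have "\<dots> = (a\<^sup>2 / d\<^sup>2) * (b - 2 * d)"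
    using d by (simp add: field_simps power2_eq_square)
  also have "\<dots> < 0"
    using d \<open>a \<noteq> 0\<close> by (intro mult_pos_neg) auto
  finally show False by simp
qed

lemma quadratic_form_add:
  fixes A :: "real ^ 'm ^ 'm"
  assumes "transpose A = A"
  shows "(x + e *\<^sub>R h) \<bullet> (A *v (x + e *\<^sub>R h))
    = x \<bullet> (A *v x) + 2 * e * (h \<bullet> (A *v x)) + e\<^sup>2 * (h \<bullet> (A *v h))"
  using symmetric_matrix_inner[OF assms, of x h]
  by (simp add: algebra_simps inner_add matrix_vector_right_distrib matrix_vector_mult_scaleR
      power2_eq_square)

text \<open>First- and second-order conditions: along each line through \<open>x\<close> the
  increment is a nonnegative quadratic in \<open>e\<close>. Its linear coefficient vanishes, in
  particular in the gradient direction \<open>g + A *v x\<close>.\<close>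

lemma quadratic_minimizer:
  fixes A :: "real ^ 'm ^ 'm"
  assumes sym: "transpose A = A"
    and min: "\<And>y. 2 * (g \<bullet> x) + x \<bullet> (A *v x) \<le> 2 * (g \<bullet> y) + y \<bullet> (A *v y)"
  shows "A *v x = - g" and "\<And>h. 0 \<le> h \<bullet> (A *v h)"
proof -
  have ineq: "0 \<le> 2 * e * (h \<bullet> (g + A *v x)) + e\<^sup>2 * (h \<bullet> (A *v h))" for e h
    using min[of "x + e *\<^sub>R h"] unfolding quadratic_form_add[OF sym]
    by (simp add: algebra_simps inner_add inner_commute)
  have "(g + A *v x) \<bullet> (g + A *v x) = 0"
    by (rule linear_coeff_zero_if_quadratic_nonneg) (rule ineq)
  then show "A *v x = - g"
    by (simp add: eq_neg_iff_add_eq_0 add.commute)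
  show "0 \<le> h \<bullet> (A *v h)" for h
    \<comment> \<open>Adding the two increments cancels their linear terms.\<close>
    using ineq[of 1 h] ineq[of "-1" h] by simp
qed

lemma matrix_vector_mult_shift:
  fixes A :: "real ^ 'm ^ 'm"
  shows "(A + mat c) *v x = A *v x + c *\<^sub>R x"
proof -
  have "mat c = c *\<^sub>R (mat 1 :: real ^ 'm ^ 'm)"
    by (simp add: mat_def vec_eq_iff)
  then show ?thesis
    by (simp add: matrix_vector_mult_add_rdistrib scaleR_matrix_vector_assoc[symmetric])
qed

lemma transpose_shift:
  fixes A :: "real ^ 'm ^ 'm"
  assumes "transpose A = A"
  shows "transpose (A + mat c) = A + mat c"
  using assms by (simp add: transpose_def mat_def vec_eq_iff)

section \<open>The least eigenvalue as minimum of the Rayleigh quotient\<close>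

lemma lambda_min_eqI:
  fixes A :: "real ^ 'm ^ 'm"
  assumes "is_eigenvalue A l" and ray: "\<And>y. l * (y \<bullet> y) \<le> y \<bullet> (A *v y)"
  shows "lambda_min A = l"
  unfolding lambda_min_def
proof (rule Least_equality)
  show "is_eigenvalue A l" by fact
  fix k assume "is_eigenvalue A k"
  then obtain v where v: "v \<noteq> 0" "A *v v = k *\<^sub>R v" by (auto simp: is_eigenvalue_def)
  then have "l * (v \<bullet> v) \<le> k * (v \<bullet> v)" using ray[of v] by simp
  with v show "l \<le> k" by simp
qed

text \<open>The form attains its minimum \<open>l\<close> on the unit sphere at some
  \<open>v\<close>. Then \<open>v\<close> globally minimizes the form of
  \<open>A + mat (- l)\<close>, and the first-order condition there is the eigenvalue
  equation.\<close>

lemma lambda_min_symmetric: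
  fixes A :: "real ^ 'm ^ 'm"
  assumes sym: "transpose A = A"
  shows "is_eigenvalue A (lambda_min A)"
    and "\<And>y. lambda_min A * (y \<bullet> y) \<le> y \<bullet> (A *v y)"
proof -
  have "continuous_on (sphere 0 1) (\<lambda>y. y \<bullet> (A *v y))"
    by (intro continuous_intros matrix_vector_mult_linear_continuous_on)
  moreover have "sphere (0 :: real ^ 'm) 1 \<noteq> {}"
    by simp
  ultimately obtain v where v: "v \<in> sphere 0 1"
    and vmin: "\<And>y. y \<in> sphere 0 1 \<Longrightarrow> v \<bullet> (A *v v) \<le> y \<bullet> (A *v y)"
    using continuous_attains_inf[of "sphere 0 1" "\<lambda>y. y \<bullet> (A *v y)"] by auto
  define l where "l = v \<bullet> (A *v v)"
  have vv: "v \<bullet> v = 1" using v by (simp add: dot_square_norm)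
  have ray: "l * (y \<bullet> y) \<le> y \<bullet> (A *v y)" for y
  proof (cases "y = 0")
    case False
    have "l \<le> (y /\<^sub>R norm y) \<bullet> (A *v (y /\<^sub>R norm y))"
      unfolding l_def using False by (intro vmin) simp
    also have "\<dots> = y \<bullet> (A *v y) / (y \<bullet> y)"
      by (simp add: matrix_vector_mult_scaleR dot_square_norm power2_eq_square field_simps)
    finally show ?thesis using False by (simp add: field_simps)
  qed simp
  \<comment> \<open>The right-hand side is \<open>- g\<close> for the zero linear term
    \<open>g = 0\<close>.\<close>
  have "(A + mat (- l)) *v v = - 0"
    by (rule quadratic_minimizer(1)[OF transpose_shift[OF sym]])
       (use ray vv in \<open>simp add: matrix_vector_mult_shift inner_add_right inner_diff_right l_def\<close>)
  then have "A *v v = l *\<^sub>R v" by (simp add: matrix_vector_mult_shift)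
  moreover have "v \<noteq> 0" using vv by auto
  ultimately have "is_eigenvalue A l" by (auto simp: is_eigenvalue_def)
  then have "lambda_min A = l" using ray by (rule lambda_min_eqI)
  with \<open>is_eigenvalue A l\<close> ray show "is_eigenvalue A (lambda_min A)"
    "\<And>y. lambda_min A * (y \<bullet> y) \<le> y \<bullet> (A *v y)" by auto
qed

section \<open>The bordered matrix and its least eigenvalue\<close>

lemma sum_UNIV_option:
  fixes f :: "'n::finite option \<Rightarrow> 'a::comm_monoid_add"
  shows "sum f UNIV = f None + (\<Sum>i\<in>UNIV. f (Some i))"
  by (simp add: UNIV_option_conv sum.reindex)

lemma transpose_bordered:
  assumes "transpose H = H"
  shows "transpose (bordered t g H) = bordered t g H"
proof -
  have "H $ i $ j = H $ j $ i" for i j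
    using arg_cong[OF assms, of "\<lambda>M. M $ j $ i"] by (simp add: transpose_def)
  then show ?thesis
    by (simp add: transpose_def bordered_def vec_eq_iff split: option.splits)
qed

lemma bordered_mult_None:
  "(bordered t g H *v y) $ None = t * y $ None + g \<bullet> (\<chi> i. y $ Some i)"
  by (simp add: matrix_vector_mult_def bordered_def sum_UNIV_option inner_vec_def)

lemma bordered_mult_Some:
  "(bordered t g H *v y) $ Some i = y $ None * g $ i + (H *v (\<chi> i. y $ Some i)) $ i"
  by (simp add: matrix_vector_mult_def bordered_def sum_UNIV_option)

lemma inner_option:
  fixes x y :: "real ^ ('n::finite) option"
  shows "x \<bullet> y = x $ None * y $ None + (\<chi> i. x $ Some i) \<bullet> (\<chi> i. y $ Some i)"
  by (simp add: inner_vec_def sum_UNIV_option)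

lemma bordered_quadratic_form:
  fixes H :: "real ^ 'n ^ 'n"
  defines "z y \<equiv> \<chi> i. y $ Some i"
  shows "y \<bullet> (bordered t g H *v y)
    = t * (y $ None)\<^sup>2 + 2 * y $ None * (g \<bullet> z y) + z y \<bullet> (H *v z y)"
proof -
  have "(\<chi> i. (bordered t g H *v y) $ Some i) = y $ None *\<^sub>R g + H *v z y"
    by (simp add: vec_eq_iff bordered_mult_Some z_def)
  then show ?thesis
    by (simp add: inner_option[of y] bordered_mult_None z_def inner_add_right inner_commute
        algebra_simps power2_eq_square)
qed

definition vec_cons :: "real \<Rightarrow> real ^ 'n \<Rightarrow> real ^ 'n option" where
  "vec_cons a x = (\<chi> i. case i of None \<Rightarrow> a | Some i' \<Rightarrow> x $ i')"

lemma vec_cons_nth [simp]: "vec_cons a x $ None = a" "vec_cons a x $ Some i = x $ i"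
  by (simp_all add: vec_cons_def)

text \<open>The Rayleigh bound at the vector \<open>(1, x)\<close>, whose squared norm is the factor
  on the left; this is the source of weak duality.\<close>

lemma lambda_min_bordered_le:
  assumes "transpose H = H"
  shows "lambda_min (bordered t g H) * (1 + (norm x)\<^sup>2)
    \<le> t + (2 * (g \<bullet> x) + x \<bullet> (H *v x))"
  using lambda_min_symmetric(2)[OF transpose_bordered[OF assms], of t g "vec_cons 1 x"]
  by (simp add: bordered_quadratic_form inner_option[of "vec_cons 1 x" "vec_cons 1 x"]
      power2_norm_eq_inner)

text \<open>The corner entry is the one for which the first row also maps \<open>(1, x)\<close> to
  \<open>- c\<close>; stationarity handles the other rows. That no eigenvalue is smaller follows by
  completing the square.\<close>

lemma lambda_min_bordered_eq:
  assumes sym: "transpose H = H"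
    and stat: "(H + mat c) *v x = - g"
    and psd: "\<And>h. 0 \<le> h \<bullet> ((H + mat c) *v h)"
  shows "lambda_min (bordered (- c - g \<bullet> x) g H) = - c"
proof (rule lambda_min_eqI)
  let ?A = "bordered (- c - g \<bullet> x) g H"
  have Hx: "H *v x = - g - c *\<^sub>R x"
    using stat unfolding matrix_vector_mult_shift by (simp add: eq_diff_eq)
  have "(?A *v vec_cons 1 x) $ i = ((- c) *\<^sub>R vec_cons 1 x) $ i" for i
    by (cases i) (simp_all add: bordered_mult_None bordered_mult_Some Hx)
  then have "?A *v vec_cons 1 x = (- c) *\<^sub>R vec_cons 1 x" by (simp add: vec_eq_iff)
  moreover have "vec_cons 1 x \<noteq> 0" by (metis vec_cons_nth(1) zero_index zero_neq_one)
  ultimately show "is_eigenvalue ?A (- c)" unfolding is_eigenvalue_def by blast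
  fix y :: "real ^ 'a option"
  define a where "a = y $ None"
  define z where "z = (\<chi> i. y $ Some i)"
  have cross: "x \<bullet> ((H + mat c) *v z) = - (g \<bullet> z)"
    using symmetric_matrix_inner[OF transpose_shift[OF sym], of x c z] stat
    by (simp add: inner_commute)
  have "0 \<le> (z + (- a) *\<^sub>R x) \<bullet> ((H + mat c) *v (z + (- a) *\<^sub>R x))" by (rule psd)
  also have "\<dots> = z \<bullet> (H *v z) + c * (z \<bullet> z) + 2 * a * (g \<bullet> z) - a\<^sup>2 * (g \<bullet> x)"
    unfolding quadratic_form_add[OF transpose_shift[OF sym]] cross stat
    by (simp add: matrix_vector_mult_shift inner_add_right inner_commute)
  finally show "- c * (y \<bullet> y) \<le> y \<bullet> (?A *v y)"
    by (simp add: bordered_quadratic_form inner_option[of y y] algebra_simps power2_eq_square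
        flip: a_def z_def)
qed

section \<open>Convexity of the joint image of the squared norm and the quadratic\<close>

lemma unit_vector_step:
  fixes x e :: "'a::real_inner"
  assumes "norm e = 1" and "(norm x)\<^sup>2 \<le> s"
  obtains \<tau> where "0 \<le> \<tau>" and "(norm (x + \<tau> *\<^sub>R e))\<^sup>2 = s"
proof
  define b where "b = x \<bullet> e"
  define d where "d = s - (norm x)\<^sup>2"
  \<comment> \<open>The larger root of the quadratic equation
    \<open>\<tau>\<^sup>2 + 2 * b * \<tau> = d\<close>.\<close>
  define \<tau> where "\<tau> = sqrt (b\<^sup>2 + d) - b"
  have d: "0 \<le> d" using assms by (simp add: d_def)
  have "b \<le> sqrt (b\<^sup>2 + d)" using d by (intro real_le_rsqrt) simp
  then show "0 \<le> \<tau>" by (simp add: \<tau>_def)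
  have "(norm (x + \<tau> *\<^sub>R e))\<^sup>2 = (norm x)\<^sup>2 + 2 * \<tau> * b + \<tau>\<^sup>2 * (norm e)\<^sup>2"
    unfolding power2_norm_eq_inner b_def
    by (simp add: inner_add inner_commute power2_eq_square algebra_simps)
  also have "\<dots> = (norm x)\<^sup>2 + (\<tau> + b)\<^sup>2 - b\<^sup>2"
    using assms by (simp add: power2_eq_square algebra_simps)
  also have "\<dots> = s" using d by (simp add: \<tau>_def d_def)
  finally show "(norm (x + \<tau> *\<^sub>R e))\<^sup>2 = s" .
qed

text \<open>The two sides differ by exactly \<open>u * v\<close> times the form at
  \<open>y - x\<close>.\<close>

lemma quadratic_form_convex:
  fixes A :: "real ^ 'm ^ 'm"
  assumes sym: "transpose A = A" and psd: "\<And>h. 0 \<le> h \<bullet> (A *v h)"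
    and uv: "0 \<le> u" "0 \<le> v" "u + v = 1"
  shows "(u *\<^sub>R x + v *\<^sub>R y) \<bullet> (A *v (u *\<^sub>R x + v *\<^sub>R y)) \<le> u * (x \<bullet> (A *v x)) + v * (y \<bullet> (A *v y))"
proof -
  have u: "u = 1 - v" using uv by simp
  have "u *\<^sub>R x + v *\<^sub>R y = x + v *\<^sub>R (y - x)" by (simp add: u algebra_simps)
  then have "(u *\<^sub>R x + v *\<^sub>R y) \<bullet> (A *v (u *\<^sub>R x + v *\<^sub>R y))
      = u * (x \<bullet> (A *v x)) + v * (y \<bullet> (A *v y)) - u * v * ((y - x) \<bullet> (A *v (y - x)))"
    using symmetric_matrix_inner[OF sym, of x y]
    by (simp add: quadratic_form_add[OF sym] u inner_diff_left inner_diff_right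
        matrix_vector_mult_diff_distrib power2_eq_square algebra_simps)
  then show ?thesis using uv psd[of "y - x"] by simp
qed

text \<open>Split the form of \<open>H\<close> into \<open>l\<close> times the squared norm and a
  convex form \<open>B\<close>. Averaging two points can only lower the squared norm below the
  average; a move along a kernel vector \<open>e\<close> of \<open>B\<close> restores it, leaving
  the \<open>B\<close> part unchanged.\<close>

lemma convex_norm_quadratic_image:
  fixes H :: "real ^ 'n ^ 'n"
  assumes sym: "transpose H = H"
  shows "convex {(s, a). \<exists>x. (norm x)\<^sup>2 = s \<and> 2 * (g \<bullet> x) + x \<bullet> (H *v x) \<le> a}"
proof -
  define l where "l = lambda_min H"
  define B where "B = H + mat (- l)"
  have symB: "transpose B = B" unfolding B_def by (rule transpose_shift[OF sym])
  have psdB: "0 \<le> h \<bullet> (B *v h)" for h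
    using lambda_min_symmetric(2)[OF sym, of h]
    by (simp add: B_def l_def matrix_vector_mult_shift inner_diff_right)
  have HB: "x \<bullet> (H *v x) = l * (norm x)\<^sup>2 + x \<bullet> (B *v x)" for x
    by (simp add: B_def matrix_vector_mult_shift inner_diff_right dot_square_norm)
  obtain w where w: "w \<noteq> 0" "H *v w = l *\<^sub>R w"
    using lambda_min_symmetric(1)[OF sym] by (auto simp: is_eigenvalue_def l_def)
  \<comment> \<open>Normalizes \<open>w\<close> and picks its sign so that moving along
    \<open>e\<close> does not increase the linear term.\<close>
  define k where "k = (if g \<bullet> w \<le> 0 then 1 else - 1) / norm w"
  define e where "e = k *\<^sub>R w"
  have e: "norm e = 1" "g \<bullet> e \<le> 0"
    using w(1) by (auto simp: e_def k_def divide_nonpos_nonneg)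
  have Be: "B *v e = 0"
    using w(2) by (simp add: e_def B_def matrix_vector_mult_shift matrix_vector_mult_scaleR)
  show ?thesis
  proof (rule convexI, clarsimp)
    fix u v a1 a2 :: real and x1 x2 :: "real ^ 'n"
    assume uv: "0 \<le> u" "0 \<le> v" "u + v = 1"
    assume a1: "2 * (g \<bullet> x1) + x1 \<bullet> (H *v x1) \<le> a1"
    assume a2: "2 * (g \<bullet> x2) + x2 \<bullet> (H *v x2) \<le> a2"
    define s where "s = u * (norm x1)\<^sup>2 + v * (norm x2)\<^sup>2"
    define x where "x = u *\<^sub>R x1 + v *\<^sub>R x2"
    have "(norm x)\<^sup>2 \<le> s"
      using quadratic_form_convex[of "mat 1 :: real ^ 'n ^ 'n", OF _ _ uv, of x1 x2]
      by (simp add: x_def s_def dot_square_norm)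
    then obtain \<tau> where \<tau>: "0 \<le> \<tau>" "(norm (x + \<tau> *\<^sub>R e))\<^sup>2 = s"
      using unit_vector_step[OF e(1)] by metis
    define y where "y = x + \<tau> *\<^sub>R e"
    have ys: "(norm y)\<^sup>2 = s" using \<tau>(2) by (simp add: y_def)
    have "e \<bullet> (B *v x) = 0"
      using symmetric_matrix_inner[OF symB, of e x] Be by simp
    then have "y \<bullet> (B *v y) = x \<bullet> (B *v x)"
      using Be by (simp add: y_def quadratic_form_add[OF symB])
    also have "\<dots> \<le> u * (x1 \<bullet> (B *v x1)) + v * (x2 \<bullet> (B *v x2))"
      unfolding x_def by (rule quadratic_form_convex[OF symB psdB uv])
    finally have yB: "y \<bullet> (B *v y) \<le> u * (x1 \<bullet> (B *v x1)) + v * (x2 \<bullet> (B *v x2))" .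
    have "g \<bullet> y \<le> u * (g \<bullet> x1) + v * (g \<bullet> x2)"
      using mult_nonneg_nonpos[OF \<tau>(1) e(2)] by (simp add: y_def x_def inner_add_right)
    with yB have "2 * (g \<bullet> y) + y \<bullet> (H *v y)
        \<le> u * (2 * (g \<bullet> x1) + x1 \<bullet> (H *v x1)) + v * (2 * (g \<bullet> x2) + x2 \<bullet> (H *v x2))"
      by (simp add: HB ys s_def algebra_simps)
    also have "\<dots> \<le> u * a1 + v * a2"
      using a1 a2 uv by (intro add_mono mult_left_mono) auto
    finally show "\<exists>y. (norm y)\<^sup>2 = u * (norm x1)\<^sup>2 + v * (norm x2)\<^sup>2
        \<and> 2 * (g \<bullet> y) + y \<bullet> (H *v y) \<le> u * a1 + v * a2"
      using ys s_def by blast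
  qed
qed

section \<open>Existence of a primal minimizer and of a multiplier\<close>

lemma quadratic_abs_bound:
  fixes H :: "real ^ 'n ^ 'n"
  obtains K where "0 \<le> K"
    and "\<And>x. \<bar>2 * (g \<bullet> x) + x \<bullet> (H *v x)\<bar> \<le> 2 * norm g * norm x + K * (norm x)\<^sup>2"
proof
  let ?K = "onorm (\<lambda>x. H *v x)"
  show "0 \<le> ?K" by (intro onorm_pos_le matrix_vector_mul_bounded_linear)
  fix x
  have "\<bar>x \<bullet> (H *v x)\<bar> \<le> norm x * norm (H *v x)" by (rule Cauchy_Schwarz_ineq2)
  also have "\<dots> \<le> norm x * (?K * norm x)"
    by (intro mult_left_mono onorm matrix_vector_mul_bounded_linear) auto
  finally have "\<bar>x \<bullet> (H *v x)\<bar> \<le> ?K * (norm x)\<^sup>2" by (simp add: power2_eq_square algebra_simps)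
  with Cauchy_Schwarz_ineq2[of g x]
  show "\<bar>2 * (g \<bullet> x) + x \<bullet> (H *v x)\<bar> \<le> 2 * norm g * norm x + ?K * (norm x)\<^sup>2" by linarith
qed

text \<open>Outside a ball the growth of \<open>\<rho>\<close> keeps the objective nonnegative,
  while at \<open>0\<close> it vanishes. Since \<open>\<rho>\<close> may be discontinuous or
  infinite, the minimum is taken over pairs \<open>(x, r)\<close> with \<open>r\<close> above
  \<open>\<rho>\<close>, where the objective is continuous and the constraint closed.\<close>

lemma regularized_minimizer:
  fixes g :: "real ^ 'n" and H :: "real ^ 'n ^ 'n" and \<rho> :: "real \<Rightarrow> ereal"
  assumes nonneg: "\<And>t. 0 \<le> \<rho> t"
    and closed: "closed_fun \<rho>"
    and zero: "\<rho> 0 = 0"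
    and coercive: "((\<lambda>t. \<rho> t / ereal t) \<longlongrightarrow> \<infinity>) at_top"
  defines "Q x \<equiv> 2 * (g \<bullet> x) + x \<bullet> (H *v x)"
  obtains x r where "\<rho> ((norm x)\<^sup>2) = ereal r"
    and "\<And>y. ereal (Q x + r) \<le> ereal (Q y) + \<rho> ((norm y)\<^sup>2)"
proof -
  obtain K where K: "0 \<le> K" "\<And>x. \<bar>Q x\<bar> \<le> 2 * norm g * norm x + K * (norm x)\<^sup>2"
    using quadratic_abs_bound[of g H] unfolding Q_def by metis
  have "eventually (\<lambda>t. ereal (K + 1) < \<rho> t / ereal t) at_top"
    using coercive unfolding tendsto_PInfty by blast
  then obtain T where T: "\<And>t. t \<ge> T \<Longrightarrow> ereal (K + 1) < \<rho> t / ereal t"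
    unfolding eventually_at_top_linorder by blast
  \<comment> \<open>For \<open>norm x > R\<close> the bounds by \<open>1\<close> and
    \<open>T\<close> put the squared norm in the range where \<open>\<rho>\<close> grows faster than
    \<open>K + 1\<close>; the third absorbs the linear term of \<open>Q\<close>.\<close>
  define R where "R = max (max 1 T) (2 * norm g)"
  \<comment> \<open>Bounds \<open>\<bar>Q x\<bar>\<close> on the ball, hence also
    \<open>\<rho>\<close> wherever the objective is negative there.\<close>
  define M where "M = 2 * norm g * R + K * R\<^sup>2"
  have R: "1 \<le> R" "T \<le> R" "2 * norm g \<le> R" by (auto simp: R_def)
  have M: "0 \<le> M" using R K by (simp add: M_def)
  have bound: "\<bar>Q x\<bar> \<le> M" if "norm x \<le> R" for x
  proof -
    have "2 * norm g * norm x + K * (norm x)\<^sup>2 \<le> M"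
      unfolding M_def using that K R by (intro add_mono mult_left_mono power_mono) auto
    with K(2)[of x] show ?thesis by linarith
  qed
  have far: "0 \<le> ereal (Q x) + \<rho> ((norm x)\<^sup>2)" if "R < norm x" for x
  proof (cases "\<rho> ((norm x)\<^sup>2)")
    case (real r)
    define s where "s = (norm x)\<^sup>2"
    have "norm x * 1 \<le> norm x * norm x" using that R by (intro mult_left_mono) auto
    then have s: "T \<le> s" "0 < s" using that R by (auto simp: s_def power2_eq_square)
    have "ereal (K + 1) < ereal (r / s)" using T[OF s(1)] real s by (simp add: s_def)
    then have r: "(K + 1) * s < r" using s by (simp add: field_simps)
    have "2 * norm g * norm x \<le> s"
      unfolding s_def power2_eq_square using that R by (intro mult_right_mono) auto
    with r K(2)[of x] have "0 \<le> Q x + r" by (simp add: s_def algebra_simps abs_le_iff)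
    with real show ?thesis by simp
  next
    case MInf
    then show ?thesis using nonneg[of "(norm x)\<^sup>2"] by simp
  qed simp
  define Z where "Z = (cball (0 :: real ^ 'n) R \<times> {0..M})
      \<inter> (\<lambda>(x, r). ((norm x)\<^sup>2, r)) -` ereal_epigraph \<rho>"
  have "closed ((\<lambda>(x :: real ^ 'n, r). ((norm x)\<^sup>2, r)) -` ereal_epigraph \<rho>)"
    using closed unfolding closed_fun_def
    by (rule closed_vimage) (auto simp: case_prod_unfold intro!: continuous_intros)
  then have "compact Z"
    unfolding Z_def by (intro compact_Int_closed compact_Times) auto
  moreover have "(0, 0) \<in> Z"
    using R M zero by (auto simp: Z_def ereal_epigraph_def)
  moreover have "continuous_on Z (\<lambda>(x, r). Q x + r)"
    unfolding Q_def case_prod_unfold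
    by (intro continuous_intros continuous_on_compose2[OF matrix_vector_mult_linear_continuous_on[of UNIV]]) auto
  ultimately obtain x r where xr: "(x, r) \<in> Z"
    and le: "\<And>y s. (y, s) \<in> Z \<Longrightarrow> Q x + r \<le> Q y + s"
    using continuous_attains_inf[of Z "\<lambda>(x, r). Q x + r"] by fastforce
  \<comment> \<open>The minimizing pair may lie strictly above the graph as far as is known, so
    \<open>r\<close> is lowered to the actual value of \<open>\<rho>\<close>.\<close>
  obtain r' where r': "\<rho> ((norm x)\<^sup>2) = ereal r'" "0 \<le> r'" "r' \<le> r"
    using xr nonneg[of "(norm x)\<^sup>2"] by (cases "\<rho> ((norm x)\<^sup>2)") (auto simp: Z_def ereal_epigraph_def)
  have "ereal (Q x + r') \<le> ereal (Q y) + \<rho> ((norm y)\<^sup>2)" for y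
  proof (cases "0 \<le> ereal (Q y) + \<rho> ((norm y)\<^sup>2)")
    case True
    have "ereal (Q x + r') \<le> 0" using le[OF \<open>(0, 0) \<in> Z\<close>] r' by (simp add: Q_def)
    then show ?thesis using True by (rule order_trans)
  next
    case False
    then have y: "norm y \<le> R" using far by force
    obtain s where s: "\<rho> ((norm y)\<^sup>2) = ereal s" "0 \<le> s" "Q y + s < 0"
      using False nonneg[of "(norm y)\<^sup>2"] by (cases "\<rho> ((norm y)\<^sup>2)") auto
    then have "(y, s) \<in> Z"
      using y bound[OF y] by (auto simp: Z_def ereal_epigraph_def)
    then show ?thesis using le r' s by fastforce
  qed
  with r' that show thesis by blast
qed

text \<open>The bound \<open>lower\<close> makes the convex sets \<open>S\<close> and
  \<open>U\<close> disjoint. A separating line that is not vertical has a slope, and its two sides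
  give the two conclusions.\<close>

lemma common_multiplier:
  fixes g :: "real ^ 'n" and H :: "real ^ 'n ^ 'n" and \<rho> :: "real \<Rightarrow> ereal"
  assumes sym: "transpose H = H"
    and nonneg: "\<And>t. 0 \<le> \<rho> t"
    and convex: "convex_fun \<rho>"
    and fin: "0 < t\<^sub>0" "\<rho> t\<^sub>0 < \<infinity>"
  defines "Q x \<equiv> 2 * (g \<bullet> x) + x \<bullet> (H *v x)"
  assumes lower: "\<And>y. ereal v \<le> ereal (Q y) + \<rho> ((norm y)\<^sup>2)"
  obtains c \<beta> where "\<And>y. \<beta> \<le> Q y + c * (norm y)\<^sup>2"
    and "\<And>s. ereal (c * s + v - \<beta>) \<le> \<rho> s"
proof -
  define S where "S = {(s, a). \<exists>x. (norm x)\<^sup>2 = s \<and> Q x \<le> a}"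
  define U where "U = {(s, b). \<exists>r. (s, r) \<in> ereal_epigraph \<rho> \<and> r + b < v}"
  have "convex S"
    unfolding S_def Q_def by (rule convex_norm_quadratic_image[OF sym])
  moreover have "convex U"
  proof (rule convexI)
    fix p q and m n :: real
    assume "p \<in> U" "q \<in> U" and mn: "0 \<le> m" "0 \<le> n" "m + n = 1"
    then obtain s1 b1 r1 s2 b2 r2 where p: "p = (s1, b1)" "(s1, r1) \<in> ereal_epigraph \<rho>" "r1 + b1 < v"
      and q: "q = (s2, b2)" "(s2, r2) \<in> ereal_epigraph \<rho>" "r2 + b2 < v"
      unfolding U_def by blast
    have "(m * s1 + n * s2, m * r1 + n * r2) \<in> ereal_epigraph \<rho>"
      using convexD[OF convex[unfolded convex_fun_def] p(2) q(2) mn] by simp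
    moreover have "m * (r1 + b1) + n * (r2 + b2) < v"
      by (rule convex_bound_lt[OF p(3) q(3) mn])
    ultimately show "m *\<^sub>R p + n *\<^sub>R q \<in> U"
      unfolding U_def p(1) q(1) by (auto simp: algebra_simps intro!: exI[of _ "m * r1 + n * r2"])
  qed
  moreover have "S \<noteq> {}" unfolding S_def by auto
  moreover obtain r\<^sub>0 where r0: "\<rho> t\<^sub>0 = ereal r\<^sub>0"
    using fin nonneg[of t\<^sub>0] by (cases "\<rho> t\<^sub>0") auto
  then have t0: "(t\<^sub>0, v - r\<^sub>0 - 1) \<in> U"
    by (auto simp: U_def ereal_epigraph_def intro!: exI[of _ r\<^sub>0])
  then have "U \<noteq> {}" by blast
  moreover have "S \<inter> U = {}"
  proof (rule ccontr)
    assume "S \<inter> U \<noteq> {}"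
    then obtain x a r where x: "Q x \<le> a" "\<rho> ((norm x)\<^sup>2) \<le> ereal r" "r + a < v"
      unfolding S_def U_def ereal_epigraph_def by auto
    have "ereal v \<le> ereal (Q x) + ereal r"
      using lower[of x] x(2) by (meson add_left_mono order_trans)
    with x show False by simp
  qed
  ultimately obtain p :: "real \<times> real" and \<beta> where "p \<noteq> 0"
    and pU: "\<And>z. z \<in> U \<Longrightarrow> p \<bullet> z \<le> \<beta>" and pS: "\<And>z. z \<in> S \<Longrightarrow> \<beta> \<le> p \<bullet> z"
    using separating_hyperplane_sets[of U S] by (metis Int_commute)
  obtain c d where p: "p = (c, d)" by fastforce
  have cd: "c \<noteq> 0 \<or> d \<noteq> 0" using \<open>p \<noteq> 0\<close> p by (auto simp: zero_prod_def)
  have upper: "\<beta> \<le> c * (norm x)\<^sup>2 + d * a" if "Q x \<le> a" for x a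
    using pS[of "((norm x)\<^sup>2, a)"] that by (auto simp: S_def p)
  have below: "c * s + d * b \<le> \<beta>" if "\<rho> s \<le> ereal r" "r + b < v" for s r b
    using pU[of "(s, b)"] that by (auto simp: U_def p ereal_epigraph_def)
  have Q0: "Q 0 = 0" by (simp add: Q_def)
  \<comment> \<open>\<open>S\<close> contains \<open>(0, a)\<close> for every
    \<open>a \<ge> 0\<close>, so a negative \<open>d\<close> would send \<open>p \<bullet> z\<close>
    below \<open>\<beta>\<close>.\<close>
  have "0 \<le> d"
  proof (rule ccontr)
    assume "\<not> 0 \<le> d"
    then have "d * (1 + \<bar>\<beta>\<bar> / (- d)) = d - \<bar>\<beta>\<bar>"
      by (simp add: field_simps)
    then have "d * (1 + \<bar>\<beta>\<bar> / (- d)) < \<beta>"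
      using \<open>\<not> 0 \<le> d\<close> by linarith
    moreover have "\<beta> \<le> c * (norm (0 :: real ^ 'n))\<^sup>2 + d * (1 + \<bar>\<beta>\<bar> / (- d))"
      using \<open>\<not> 0 \<le> d\<close> by (intro upper) (simp add: Q0 divide_nonneg_neg add_nonneg_nonneg)
    ultimately show False by simp
  qed
  \<comment> \<open>A vertical line is impossible: \<open>S\<close> has points over \<open>0\<close>
    and over \<open>2 * t\<^sub>0\<close>, on both sides of the point of \<open>U\<close> over
    \<open>t\<^sub>0\<close>. This forces \<open>c = 0\<close> as well.\<close>
  moreover have "d \<noteq> 0"
  proof
    assume [simp]: "d = 0"
    have "\<beta> \<le> 0" using upper[of 0 0] by (simp add: Q0)
    moreover have "c * t\<^sub>0 \<le> \<beta>" using below[of t\<^sub>0 r\<^sub>0 "v - r\<^sub>0 - 1"] r0 by simp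
    moreover obtain x :: "real ^ 'n" where "norm x = sqrt (2 * t\<^sub>0)"
      using fin(1) vector_choose_size by (metis real_sqrt_ge_0_iff less_imp_le mult_nonneg_nonneg zero_le_numeral)
    then have "\<beta> \<le> c * (2 * t\<^sub>0)" using upper[of x "Q x"] fin(1) by simp
    ultimately have "c * t\<^sub>0 = 0" by linarith
    then show False using cd fin(1) by simp
  qed
  ultimately have d: "0 < d" by simp
  show thesis
  proof
    show "\<beta> / d \<le> Q y + c / d * (norm y)\<^sup>2" for y
      using upper[of y "Q y"] d by (simp add: field_simps)
    show "ereal (c / d * s + v - \<beta> / d) \<le> \<rho> s" for s
    proof (cases "\<rho> s")
      case (real r)
      have "c / d * s + v - \<beta> / d \<le> r"
      \<comment> \<open>The inequality defining \<open>U\<close> is strict, so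
        \<open>b = v - r\<close> is only approached.\<close>
      proof (rule field_le_epsilon)
        fix \<epsilon> :: real assume "0 < \<epsilon>"
        then have "c * s + d * (v - r - \<epsilon>) \<le> \<beta>" using below[of s r "v - r - \<epsilon>"] real by simp
        then have "(c * s + d * (v - r - \<epsilon>)) / d \<le> \<beta> / d" using d by (intro divide_right_mono) auto
        then show "c / d * s + v - \<beta> / d \<le> r + \<epsilon>" using d by (simp add: add_divide_distrib)
      qed
      with real show ?thesis by simp
    next
      case MInf
      then show ?thesis using nonneg[of s] by simp
    qed simp
  qed
qed

section \<open>Strong duality and dual attainment\<close>

theorem theorem2p3:
  fixes g :: "real ^ 'n" and H :: "real ^ 'n ^ 'n" and \<rho> :: "real \<Rightarrow> ereal"
  assumes g_nz: "g \<noteq> 0"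
    and H_sym: "transpose H = H"
    and rho_nonneg: "\<And>t. 0 \<le> \<rho> t"
    and rho_proper: "proper_fun \<rho>"
    and rho_closed: "closed_fun \<rho>"
    and rho_convex: "convex_fun \<rho>"
    and rho_0: "\<rho> 0 = 0"
    and rho_mono: "mono \<rho>"
    and rho_nonpos: "\<And>t. t \<le> 0 \<Longrightarrow> \<rho> t = 0"
    and rho_fin: "\<exists>t\<^sub>0>0. \<rho> t\<^sub>0 < \<infinity>"
    and rho_coercive: "((\<lambda>t. \<rho> t / ereal t) \<longlongrightarrow> \<infinity>) at_top"
  shows "v_RWd \<rho> g H = v_rho_r \<rho> g H
    \<and> (\<exists>t. k_hat \<rho> g H t - ereal t = v_RWd \<rho> g H)"
proof -
  define Q where "Q x = 2 * (g \<bullet> x) + x \<bullet> (H *v x)" for x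
  obtain x r where r: "\<rho> ((norm x)\<^sup>2) = ereal r"
    and xmin: "\<And>y. ereal (Q x + r) \<le> ereal (Q y) + \<rho> ((norm y)\<^sup>2)"
    using regularized_minimizer[OF rho_nonneg rho_closed rho_0 rho_coercive, of g H]
    unfolding Q_def by metis
  define v where "v = Q x + r"
  have primal: "v_rho_r \<rho> g H = ereal v"
    unfolding v_rho_r_def v_def
  proof (rule antisym)
    show "(INF y. ereal (2 * (g \<bullet> y) + y \<bullet> (H *v y)) + \<rho> ((norm y)\<^sup>2)) \<le> ereal (Q x + r)"
      by (rule INF_lower2[of x]) (simp_all add: r Q_def)
  qed (use xmin in \<open>auto simp: Q_def intro!: INF_greatest\<close>)
  obtain t\<^sub>0 where "0 < t\<^sub>0" "\<rho> t\<^sub>0 < \<infinity>" using rho_fin by blast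
  then obtain c \<beta> where cQ: "\<And>y. \<beta> \<le> Q y + c * (norm y)\<^sup>2"
    and c\<rho>: "\<And>s. ereal (c * s + v - \<beta>) \<le> \<rho> s"
    using common_multiplier[OF H_sym rho_nonneg rho_convex, of t\<^sub>0 v g] xmin
    unfolding Q_def v_def by metis
  \<comment> \<open>Both multiplier inequalities are tight at the primal minimizer:
    \<open>cQ\<close> gives one direction, \<open>c\<rho>\<close> at its squared norm the
    other.\<close>
  have \<beta>: "Q x + c * (norm x)\<^sup>2 = \<beta>"
    using cQ[of x] c\<rho>[of "(norm x)\<^sup>2"] r by (simp add: v_def)
  have Qc: "2 * (g \<bullet> y) + y \<bullet> ((H + mat c) *v y) = Q y + c * (norm y)\<^sup>2" for y
    by (simp add: Q_def matrix_vector_mult_shift inner_add_right dot_square_norm)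
  have opt: "2 * (g \<bullet> x) + x \<bullet> ((H + mat c) *v x) \<le> 2 * (g \<bullet> y) + y \<bullet> ((H + mat c) *v y)" for y
    unfolding Qc \<beta> by (rule cQ)
  note stat = quadratic_minimizer[OF transpose_shift[OF H_sym] opt]
  define t where "t = - c - g \<bullet> x"
  have lam: "lambda_min (bordered t g H) = - c"
    unfolding t_def using lambda_min_bordered_eq[OF H_sym stat] .
  \<comment> \<open>By stationarity the minimal value of the shifted quadratic is
    \<open>2 * (g \<bullet> x) - g \<bullet> x\<close>.\<close>
  have gx: "g \<bullet> x = \<beta>"
    using Qc[of x] \<beta> stat(1) by (simp add: inner_commute)
  have strong: "ereal v \<le> k_hat \<rho> g H t - ereal t"
  proof -
    \<comment> \<open>The affine minorant of \<open>\<rho>\<close> at \<open>\<gamma> - 1\<close>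
      has slope \<open>c\<close>, which cancels against the eigenvalue \<open>- c\<close>; what
      remains is independent of \<open>\<gamma>\<close>.\<close>
    have "ereal (v + t) \<le> \<rho> (\<gamma> - 1) + ereal (\<gamma> * (- c))" for \<gamma>
    proof -
      have "ereal (v + t) = ereal (c * (\<gamma> - 1) + v - \<beta>) + ereal (\<gamma> * (- c))"
        by (simp add: t_def gx algebra_simps)
      also have "\<dots> \<le> \<rho> (\<gamma> - 1) + ereal (\<gamma> * (- c))" by (intro add_right_mono c\<rho>)
      finally show ?thesis .
    qed
    then have "ereal (v + t) \<le> k_hat \<rho> g H t"
      unfolding k_hat_def lam by (intro INF_greatest)
    then show ?thesis by (simp add: ereal_le_minus)
  qed
  have weak: "k_hat \<rho> g H t' - ereal t' \<le> ereal v" for t'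
  proof -
    \<comment> \<open>This choice turns \<open>\<rho> (\<gamma> - 1)\<close> into the primal penalty
      at \<open>x\<close>, and it is the squared norm of \<open>(1, x)\<close> in the Rayleigh
      bound. Testing at the primal minimizer suffices.\<close>
    let ?\<gamma> = "1 + (norm x)\<^sup>2" and ?l = "lambda_min (bordered t' g H)"
    have "k_hat \<rho> g H t' \<le> \<rho> (?\<gamma> - 1) + ereal (?\<gamma> * ?l)"
      unfolding k_hat_def by (rule INF_lower) simp
    also have "\<dots> = ereal (r + ?\<gamma> * ?l)" using r by simp
    also have "\<dots> \<le> ereal (v + t')"
      using lambda_min_bordered_le[OF H_sym, of t' g x] by (simp add: v_def Q_def mult.commute)
    finally show ?thesis by (simp add: ereal_minus_le)
  qed
  have dual: "k_hat \<rho> g H t - ereal t = ereal v"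
    using weak strong by (rule antisym)
  have "v_RWd \<rho> g H = ereal v"
    unfolding v_RWd_def
  proof (rule antisym)
    show "(SUP t. k_hat \<rho> g H t - ereal t) \<le> ereal v" by (intro SUP_least weak)
    show "ereal v \<le> (SUP t. k_hat \<rho> g H t - ereal t)" using strong by (rule SUP_upper2[OF UNIV_I])
  qed
  with primal dual show ?thesis by auto
qed

end
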